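(* Let $0\neq\psi\in(\mathfrak{n}^+/[\mathfrak{n}^+,\mathfrak{n}^+])^*$, and let $V,W$ be objects of $\mathcal{W}_f(\psi)$ that are Whittaker modules with cyclic Whittaker vectors $v\in V$, $w\in W$. Let $\mathrm{Ann}_{Z(\mathfrak{g})}(v)=\langle p(z)\rangle$ and $\mathrm{Ann}_{Z(\mathfrak{g})}(w)=\langle q(z)\rangle$. Then $$\mathrm{Hom}_{\mathfrak{g}}(V,W)\cong\mathbb{C}[z]/\langle \gcd(p(z),q(z))\rangle,$$ where $\overline{s}(z)\in\mathbb{C}[z]/\langle\gcd(p(z),q(z))\rangle$ (the class of $s(z)\in\mathbb{C}[z]$) defines the homomorphism $\phi_s:V\to W$ given by $$v\mapsto s(z)\cdot\frac{q(z)}{\gcd(p(z),q(z))}\,w.$$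
   Context: $\mathfrak{g}$ is the Virasoro Lie algebra over $\mathbb{C}$, with basis $\{z, d_k \mid k \in \mathbb{Z}\}$ and bracket $[d_k,d_j]=(k-j)d_{k+j}+\delta_{j,-k}\frac{k^3-k}{12}z$, $[z,d_k]=0$; $\mathfrak{n}^+=\mathrm{span}_{\mathbb{C}}\{d_k \mid k>0\}$. Elements of $(\mathfrak{n}^+/[\mathfrak{n}^+,\mathfrak{n}^+])^*$ are identified with Lie algebra homomorphisms $\mathfrak{n}^+\to\mathbb{C}$. $Z(\mathfrak{g})=\mathbb{C}[z]$ is the center of $U(\mathfrak{g})$. $\mathcal{W}_f(\psi)$ is the category of $\mathfrak{g}$-modules $V$ of finite composition length on which $\mathfrak{n}^+$ acts locally finitely and such that for every $v\in V$ and $x\in\mathfrak{n}^+$, $(x-\psi(x))^kv=0$ for $k\gg0$. A Whittaker vector (of type $\psi$) is a vector $w$ with $xw=\psi(x)w$ for all $x\in\mathfrak{n}^+$; a Whittaker module is a module generated by a Whittaker vector, called a cyclic Whittaker vector. $\mathrm{Ann}_{Z(\mathfrak{g})}(v)=\{u\in Z(\mathfrak{g})\mid uv=0\}$. The isomorphism is one of complex vector spaces. *)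

theory Defs
  imports
    "HOL-Library.Poly_Mapping"
    "HOL-Computational_Algebra.Computational_Algebra"
    "HOL-Computational_Algebra.Field_as_Ring"
begin

section \<open>Lie algebras and their modules\<close>

locale lie_algebra = L: vector_space scaleL
  for scaleL :: "'f::field \<Rightarrow> 'g::ab_group_add \<Rightarrow> 'g" +
  fixes bracket :: "'g \<Rightarrow> 'g \<Rightarrow> 'g"
  assumes bracket_add_left: "bracket (x + y) u = bracket x u + bracket y u"
    and bracket_add_right: "bracket u (x + y) = bracket u x + bracket u y"
    and bracket_scale_left: "bracket (scaleL c x) y = scaleL c (bracket x y)"
    and bracket_scale_right: "bracket x (scaleL c y) = scaleL c (bracket x y)"
    and bracket_self: "bracket x x = 0"
    and jacobi:
      "bracket x (bracket y u) + bracket y (bracket u x) + bracket u (bracket x y) = 0"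

locale lie_module = lie_algebra scaleL bracket + V: vector_space scaleV
  for scaleL :: "'f::field \<Rightarrow> 'g::ab_group_add \<Rightarrow> 'g"
    and bracket :: "'g \<Rightarrow> 'g \<Rightarrow> 'g"
    and scaleV :: "'f \<Rightarrow> 'v::ab_group_add \<Rightarrow> 'v" +
  fixes act :: "'g \<Rightarrow> 'v \<Rightarrow> 'v"
  assumes act_add_left: "act (x + y) v = act x v + act y v"
    and act_add_right: "act x (u + v) = act x u + act x v"
    and act_scale_left: "act (scaleL c x) v = scaleV c (act x v)"
    and act_scale_right: "act x (scaleV c v) = scaleV c (act x v)"
    and act_bracket: "act (bracket x y) v = act x (act y v) - act y (act x v)"


section \<open>The Virasoro algebra\<close>

datatype vir_index = Central | Vir int

text \<open>An element is the finitely supported family of its coordinates in the basis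
  \<open>z\<close>, \<open>d k\<close>. The ring multiplication of \<^theory>\<open>HOL-Library.Poly_Mapping\<close> plays no role here.\<close>

type_synonym virasoro = "vir_index \<Rightarrow>\<^sub>0 complex"

definition vir_z :: virasoro where
  "vir_z = Poly_Mapping.single Central 1"

definition vir_d :: "int \<Rightarrow> virasoro" where
  "vir_d k = Poly_Mapping.single (Vir k) 1"

definition vir_scale :: "complex \<Rightarrow> virasoro \<Rightarrow> virasoro" where
  "vir_scale c x = Poly_Mapping.map ((*) c) x"

fun vir_basis_bracket :: "vir_index \<Rightarrow> vir_index \<Rightarrow> virasoro" where
  "vir_basis_bracket (Vir k) (Vir j) =
     vir_scale (of_int (k - j)) (vir_d (k + j)) +
     (if j = - k then vir_scale (of_int (k ^ 3 - k) / 12) vir_z else 0)"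
| "vir_basis_bracket Central b = 0"
| "vir_basis_bracket a Central = 0"

definition vir_bracket :: "virasoro \<Rightarrow> virasoro \<Rightarrow> virasoro" where
  "vir_bracket x y =
     (\<Sum>a\<in>Poly_Mapping.keys x. \<Sum>b\<in>Poly_Mapping.keys y.
        vir_scale (Poly_Mapping.lookup x a * Poly_Mapping.lookup y b) (vir_basis_bracket a b))"

lemma lookup_vir_scale [simp]:
  "Poly_Mapping.lookup (vir_scale c x) a = c * Poly_Mapping.lookup x a"
  by (simp add: vir_scale_def Poly_Mapping.map.rep_eq when_def)

lemma vector_space_vir_scale: "vector_space vir_scale"
  by unfold_locales (auto intro!: poly_mapping_eqI simp: lookup_add algebra_simps)

interpretation vir_vs: vector_space vir_scale
  by (fact vector_space_vir_scale)

lemma vir_bracket_superset: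
  assumes "finite A" "finite B" "Poly_Mapping.keys x \<subseteq> A" "Poly_Mapping.keys y \<subseteq> B"
  shows "vir_bracket x y = (\<Sum>a\<in>A. \<Sum>b\<in>B.
    vir_scale (Poly_Mapping.lookup x a * Poly_Mapping.lookup y b) (vir_basis_bracket a b))"
proof -
  let ?t = "\<lambda>a b. vir_scale (Poly_Mapping.lookup x a * Poly_Mapping.lookup y b)
    (vir_basis_bracket a b)"
  have z: "?t a b = 0" if "a \<notin> Poly_Mapping.keys x \<or> b \<notin> Poly_Mapping.keys y" for a b
    using that by (auto simp: in_keys_iff)
  have "(\<Sum>a\<in>A. \<Sum>b\<in>B. ?t a b) = (\<Sum>a\<in>A. \<Sum>b\<in>Poly_Mapping.keys y. ?t a b)"
    using assms by (intro sum.cong refl sum.mono_neutral_right) (auto simp: z)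
  also have "\<dots> = vir_bracket x y"
    unfolding vir_bracket_def
    using assms by (intro sum.mono_neutral_right) (auto simp: z intro!: sum.neutral)
  finally show ?thesis by simp
qed

lemma vir_bracket_add_left: "vir_bracket (x + y) u = vir_bracket x u + vir_bracket y u"
proof -
  let ?A = "Poly_Mapping.keys x \<union> Poly_Mapping.keys y \<union> Poly_Mapping.keys (x + y)"
  have *: "vir_bracket w u = (\<Sum>a\<in>?A. \<Sum>b\<in>Poly_Mapping.keys u.
      vir_scale (Poly_Mapping.lookup w a * Poly_Mapping.lookup u b) (vir_basis_bracket a b))"
    if "Poly_Mapping.keys w \<subseteq> ?A" for w
    using that by (intro vir_bracket_superset) auto
  show ?thesis
    by (subst (1 2 3) *)
      (auto simp: lookup_add distrib_right vir_vs.scale_left_distrib sum.distrib)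
qed

lemma vir_bracket_add_right: "vir_bracket u (x + y) = vir_bracket u x + vir_bracket u y"
proof -
  let ?B = "Poly_Mapping.keys x \<union> Poly_Mapping.keys y \<union> Poly_Mapping.keys (x + y)"
  have *: "vir_bracket u w = (\<Sum>a\<in>Poly_Mapping.keys u. \<Sum>b\<in>?B.
      vir_scale (Poly_Mapping.lookup u a * Poly_Mapping.lookup w b) (vir_basis_bracket a b))"
    if "Poly_Mapping.keys w \<subseteq> ?B" for w
    using that by (intro vir_bracket_superset) auto
  show ?thesis
    by (subst (1 2 3) *)
      (auto simp: lookup_add distrib_left vir_vs.scale_left_distrib sum.distrib)
qed

lemma vir_bracket_scale_left: "vir_bracket (vir_scale c x) y = vir_scale c (vir_bracket x y)"
proof -
  have "Poly_Mapping.keys (vir_scale c x) \<subseteq> Poly_Mapping.keys x"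
    by (auto simp: in_keys_iff)
  then have "vir_bracket (vir_scale c x) y =
      (\<Sum>a\<in>Poly_Mapping.keys x. \<Sum>b\<in>Poly_Mapping.keys y. vir_scale
        (Poly_Mapping.lookup (vir_scale c x) a * Poly_Mapping.lookup y b) (vir_basis_bracket a b))"
    by (intro vir_bracket_superset) auto
  then show ?thesis
    by (simp add: vir_bracket_def vir_vs.scale_sum_right mult.assoc)
qed

lemma vir_bracket_scale_right: "vir_bracket x (vir_scale c y) = vir_scale c (vir_bracket x y)"
proof -
  have "Poly_Mapping.keys (vir_scale c y) \<subseteq> Poly_Mapping.keys y"
    by (auto simp: in_keys_iff)
  then have "vir_bracket x (vir_scale c y) =
      (\<Sum>a\<in>Poly_Mapping.keys x. \<Sum>b\<in>Poly_Mapping.keys y. vir_scale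
        (Poly_Mapping.lookup x a * Poly_Mapping.lookup (vir_scale c y) b) (vir_basis_bracket a b))"
    by (intro vir_bracket_superset) auto
  then show ?thesis
    by (simp add: vir_bracket_def vir_vs.scale_sum_right ac_simps)
qed

lemma vir_bracket_single [simp]:
  "vir_bracket (Poly_Mapping.single a 1) (Poly_Mapping.single b 1) = vir_basis_bracket a b"
  by (simp add: vir_bracket_def)

lemma vir_bracket_zero [simp]: "vir_bracket 0 x = 0" "vir_bracket x 0 = 0"
  by (simp_all add: vir_bracket_def)

lemma vir_bracket_z [simp]: "vir_bracket vir_z x = 0" "vir_bracket x vir_z = 0"
proof -
  show "vir_bracket vir_z x = 0"
    by (simp add: vir_bracket_def vir_z_def)
  have "vir_basis_bracket a Central = 0" for a
    by (cases a) auto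
  then show "vir_bracket x vir_z = 0"
    by (simp add: vir_bracket_def vir_z_def)
qed

lemma vir_bracket_d:
  "vir_bracket (vir_d k) (vir_d j) =
     vir_scale (of_int (k - j)) (vir_d (k + j)) +
     (if j = - k then vir_scale (of_int (k ^ 3 - k) / 12) vir_z else 0)"
  by (simp add: vir_d_def[of k] vir_d_def[of j])

lemma vir_induct [case_names add scale z d]:
  assumes "\<And>x y. P x \<Longrightarrow> P y \<Longrightarrow> P (x + y)" "\<And>c x. P x \<Longrightarrow> P (vir_scale c x)"
    and "P vir_z" "\<And>k. P (vir_d k)"
  shows "P x"
proof (induction x rule: update_induct)
  case const
  show ?case using assms(2)[OF assms(3), of 0] by simp
next
  case (update f a b)
  have "Poly_Mapping.update a b f = f + vir_scale b (Poly_Mapping.single a 1)"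
    using update(1)
    by (auto intro!: poly_mapping_eqI simp: lookup_update lookup_add lookup_single when_def
        in_keys_iff)
  moreover have "P (Poly_Mapping.single a 1)"
    using assms(3,4) by (cases a) (auto simp: vir_z_def vir_d_def)
  ultimately show ?case
    using assms(1,2) update(3) by simp
qed

lemma vir_bracket_antisym: "vir_bracket x y + vir_bracket y x = 0"
proof (induction x rule: vir_induct)
  case (add x1 x2)
  then show ?case by (simp add: vir_bracket_add_left vir_bracket_add_right add_eq_0_iff algebra_simps)
next
  case (scale c x)
  then show ?case
    by (metis vir_bracket_scale_left vir_bracket_scale_right vir_vs.scale_right_distrib
        vir_vs.scale_zero_right)
next
  case z
  show ?case by simp
next
  case (d k)
  show ?case
  proof (induction y rule: vir_induct)
    case (add x1 x2)
    then show ?case by (simp add: vir_bracket_add_left vir_bracket_add_right add_eq_0_iff algebra_simps)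
  next
    case (scale c x)
    then show ?case
      by (metis vir_bracket_scale_left vir_bracket_scale_right vir_vs.scale_right_distrib
          vir_vs.scale_zero_right)
  next
    case z
    show ?case by simp
  next
    case (d j)
    show ?case
      by (auto intro!: poly_mapping_eqI simp: vir_bracket_d lookup_add algebra_simps
          divide_simps power3_eq_cube)
  qed
qed

lemma vir_jacobi_d:
  "vir_bracket (vir_d i) (vir_bracket (vir_d j) (vir_d k)) +
   vir_bracket (vir_d j) (vir_bracket (vir_d k) (vir_d i)) +
   vir_bracket (vir_d k) (vir_bracket (vir_d i) (vir_d j)) = 0"
proof -
  have *: "vir_bracket (vir_d i) (vir_bracket (vir_d j) (vir_d k)) =
     vir_scale (of_int ((j - k) * (i - j - k))) (vir_d (i + j + k)) +
     vir_scale (if i + j + k = 0 then of_int ((j - k) * (i ^ 3 - i)) / 12 else 0) vir_z"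
    for i j k
  proof -
    have "vir_bracket (vir_d i) (vir_bracket (vir_d j) (vir_d k)) =
        vir_scale (of_int (j - k)) (vir_bracket (vir_d i) (vir_d (j + k)))"
      by (subst vir_bracket_d[of j k])
        (simp add: vir_bracket_add_right vir_bracket_scale_right)
    moreover have "j + k = - i \<longleftrightarrow> i + j + k = 0" by auto
    ultimately show ?thesis
      by (simp add: vir_bracket_d vir_vs.scale_right_distrib diff_diff_eq add.assoc)
  qed
  have 1: "(j - k) * (i - j - k) + (k - i) * (j - k - i) + (i - j) * (k - i - j) = 0"
    by (simp add: algebra_simps)
  have 2: "(j - k) * (i ^ 3 - i) + (k - i) * (j ^ 3 - j) + (i - j) * (k ^ 3 - k) = 0"
    if "i + j + k = 0"
  proof -
    have k: "k = - i - j" using that by simp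
    show ?thesis unfolding k by (simp add: power3_eq_cube algebra_simps)
  qed
  have 3: "vir_scale a u + vir_scale a' z + (vir_scale b u + vir_scale b' z) +
      (vir_scale c u + vir_scale c' z) = 0"
    if "a + b + c = 0" "a' + b' + c' = 0" for a b c a' b' c' u z
  proof -
    have "vir_scale a u + vir_scale a' z + (vir_scale b u + vir_scale b' z) +
      (vir_scale c u + vir_scale c' z) = vir_scale (a + b + c) u + vir_scale (a' + b' + c') z"
      by (simp add: vir_vs.scale_left_distrib)
    then show ?thesis using that by simp
  qed
  have e: "j + k + i = i + j + k" "k + i + j = i + j + k" by simp_all
  show ?thesis
    unfolding * e
  proof (rule 3)
    show "complex_of_int ((j - k) * (i - j - k)) + of_int ((k - i) * (j - k - i)) +
      of_int ((i - j) * (k - i - j)) = 0"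
      using 1 by (metis of_int_0 of_int_add)
    show "(if i + j + k = 0 then complex_of_int ((j - k) * (i ^ 3 - i)) / 12 else 0) +
      (if i + j + k = 0 then of_int ((k - i) * (j ^ 3 - j)) / 12 else 0) +
      (if i + j + k = 0 then of_int ((i - j) * (k ^ 3 - k)) / 12 else 0) = 0"
      using arg_cong[OF 2, of complex_of_int]
      by (auto simp flip: add_divide_distrib)
  qed
qed

lemma vir_jacobi:
  "vir_bracket x (vir_bracket y u) + vir_bracket y (vir_bracket u x) +
   vir_bracket u (vir_bracket x y) = 0" (is "?J x y u = 0")
proof -
  have cyc_scale: "vir_scale c a + vir_scale c b + vir_scale c d = 0" if "a + b + d = 0" for c a b d
    using that by (metis vir_vs.scale_right_distrib vir_vs.scale_zero_right)
  have cyc_add: "a + a' + (b + b') + (d + d') = 0" if "a + b + d = 0" "a' + b' + d' = 0"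
    for a b d a' b' d' :: virasoro
  proof -
    have "a + a' + (b + b') + (d + d') = (a + b + d) + (a' + b' + d')" by simp
    with that show ?thesis by simp
  qed
  note lin = vir_bracket_add_left vir_bracket_add_right vir_bracket_scale_left
    vir_bracket_scale_right
  have 1: "?J (vir_d i) (vir_d j) u = 0" for i j
  proof (induction u rule: vir_induct)
    case (add x y) then show ?case by (simp only: lin cyc_add)
  next
    case (scale c x) then show ?case by (simp only: lin cyc_scale)
  qed (simp_all add: vir_jacobi_d)
  have 2: "?J (vir_d i) y u = 0" for i
  proof (induction y rule: vir_induct)
    case (add x y) then show ?case by (simp only: lin cyc_add)
  next
    case (scale c x) then show ?case by (simp only: lin cyc_scale)
  qed (simp_all add: 1)
  show ?thesis
  proof (induction x rule: vir_induct)
    case (add x y) then show ?case by (simp only: lin cyc_add)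
  next
    case (scale c x) then show ?case by (simp only: lin cyc_scale)
  qed (simp_all add: 2)
qed

interpretation virasoro: lie_algebra vir_scale vir_bracket
proof
  show "vir_bracket x x = 0" for x
  proof -
    have "vir_scale 2 (vir_bracket x x) = vir_bracket x x + vir_bracket x x"
      by (auto intro!: poly_mapping_eqI simp: lookup_add)
    then have "vir_scale 2 (vir_bracket x x) = 0"
      by (simp only: vir_bracket_antisym)
    then show ?thesis by simp
  qed
qed (simp_all add: vir_bracket_add_left vir_bracket_add_right vir_bracket_scale_left
    vir_bracket_scale_right vir_jacobi)

definition nplus :: "virasoro set" where
  "nplus = vir_vs.span (vir_d ` {k. k > 0})"

text \<open>Lie algebra homomorphisms from \<open>nplus\<close> to the abelian Lie algebra \<open>\<complex>\<close>, i.e. the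
  linear functionals on \<open>nplus / [nplus, nplus]\<close>. The values of \<open>\<psi>\<close> outside \<open>nplus\<close> are
  unconstrained and never used.\<close>

definition nplus_character :: "(virasoro \<Rightarrow> complex) \<Rightarrow> bool" where
  "nplus_character \<psi> \<longleftrightarrow>
     (\<forall>x\<in>nplus. \<forall>y\<in>nplus. \<psi> (x + y) = \<psi> x + \<psi> y) \<and>
     (\<forall>c. \<forall>x\<in>nplus. \<psi> (vir_scale c x) = c * \<psi> x) \<and>
     (\<forall>x\<in>nplus. \<forall>y\<in>nplus. \<psi> (vir_bracket x y) = 0)"


section \<open>Virasoro modules\<close>

text \<open>A module is a complex vector space structure \<open>scale\<close> on a whole type \<open>'v\<close> together with an
  action \<open>act\<close>.\<close>

abbreviation vir_module ::
  "(complex \<Rightarrow> 'v \<Rightarrow> 'v::ab_group_add) \<Rightarrow> (virasoro \<Rightarrow> 'v \<Rightarrow> 'v) \<Rightarrow> bool" where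
  "vir_module scale act \<equiv> lie_module vir_scale vir_bracket scale act"

definition stable_subspace ::
  "(complex \<Rightarrow> 'v \<Rightarrow> 'v::ab_group_add) \<Rightarrow> (virasoro \<Rightarrow> 'v \<Rightarrow> 'v) \<Rightarrow> virasoro set \<Rightarrow> 'v set \<Rightarrow> bool" where
  "stable_subspace scale act A S \<longleftrightarrow>
     module.subspace scale S \<and> (\<forall>x\<in>A. \<forall>v\<in>S. act x v \<in> S)"

abbreviation vir_submodule ::
  "(complex \<Rightarrow> 'v \<Rightarrow> 'v::ab_group_add) \<Rightarrow> (virasoro \<Rightarrow> 'v \<Rightarrow> 'v) \<Rightarrow> 'v set \<Rightarrow> bool" where
  "vir_submodule scale act S \<equiv> stable_subspace scale act UNIV S"

text \<open>For a Lie subalgebra \<open>A\<close> this is \<open>U(A) v\<close>.\<close>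

definition generated_by ::
  "(complex \<Rightarrow> 'v \<Rightarrow> 'v::ab_group_add) \<Rightarrow> (virasoro \<Rightarrow> 'v \<Rightarrow> 'v) \<Rightarrow> virasoro set \<Rightarrow> 'v \<Rightarrow> 'v set" where
  "generated_by scale act A v = \<Inter> {S. stable_subspace scale act A S \<and> v \<in> S}"

text \<open>Existence of a composition series; simplicity of the factors is expressed by the absence of
  submodules strictly between consecutive terms.\<close>

definition finite_length ::
  "(complex \<Rightarrow> 'v \<Rightarrow> 'v::ab_group_add) \<Rightarrow> (virasoro \<Rightarrow> 'v \<Rightarrow> 'v) \<Rightarrow> bool" where
  "finite_length scale act \<longleftrightarrow>
     (\<exists>(n::nat) M. M 0 = {0} \<and> M n = UNIV \<and>
        (\<forall>i\<le>n. vir_submodule scale act (M i)) \<and>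
        (\<forall>i<n. M i \<subset> M (Suc i) \<and>
           \<not> (\<exists>N. vir_submodule scale act N \<and> M i \<subset> N \<and> N \<subset> M (Suc i))))"

definition nplus_locally_finite ::
  "(complex \<Rightarrow> 'v \<Rightarrow> 'v::ab_group_add) \<Rightarrow> (virasoro \<Rightarrow> 'v \<Rightarrow> 'v) \<Rightarrow> bool" where
  "nplus_locally_finite scale act \<longleftrightarrow>
     (\<forall>v. \<exists>B. finite B \<and> generated_by scale act nplus v \<subseteq> module.span scale B)"

text \<open>The objects of the category \<open>W\<^sub>f(\<psi>)\<close>.\<close>

definition Wf_object ::
  "(virasoro \<Rightarrow> complex) \<Rightarrow> (complex \<Rightarrow> 'v \<Rightarrow> 'v::ab_group_add) \<Rightarrow> (virasoro \<Rightarrow> 'v \<Rightarrow> 'v) \<Rightarrow> bool" where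
  "Wf_object \<psi> scale act \<longleftrightarrow>
     vir_module scale act \<and> finite_length scale act \<and> nplus_locally_finite scale act \<and>
     (\<forall>v. \<forall>x\<in>nplus. \<exists>K. \<forall>k\<ge>K. ((\<lambda>u. act x u - scale (\<psi> x) u) ^^ k) v = 0)"

definition whittaker_vector ::
  "(virasoro \<Rightarrow> complex) \<Rightarrow> (complex \<Rightarrow> 'v \<Rightarrow> 'v::ab_group_add) \<Rightarrow> (virasoro \<Rightarrow> 'v \<Rightarrow> 'v) \<Rightarrow> 'v \<Rightarrow> bool" where
  "whittaker_vector \<psi> scale act w \<longleftrightarrow> (\<forall>x\<in>nplus. act x w = scale (\<psi> x) w)"

definition cyclic_whittaker_vector ::
  "(virasoro \<Rightarrow> complex) \<Rightarrow> (complex \<Rightarrow> 'v \<Rightarrow> 'v::ab_group_add) \<Rightarrow> (virasoro \<Rightarrow> 'v \<Rightarrow> 'v) \<Rightarrow> 'v \<Rightarrow> bool" where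
  "cyclic_whittaker_vector \<psi> scale act w \<longleftrightarrow>
     whittaker_vector \<psi> scale act w \<and> generated_by scale act UNIV w = UNIV"

text \<open>The centre of \<open>U(\<gg>)\<close> is \<open>\<complex>[z]\<close>, so its elements are complex polynomials, acting through
  the operator \<open>act vir_z\<close>.\<close>

definition center_act ::
  "(complex \<Rightarrow> 'v \<Rightarrow> 'v::ab_group_add) \<Rightarrow> (virasoro \<Rightarrow> 'v \<Rightarrow> 'v) \<Rightarrow> complex poly \<Rightarrow> 'v \<Rightarrow> 'v" where
  "center_act scale act p v =
     (\<Sum>i\<le>Polynomial.degree p. scale (Polynomial.coeff p i) ((act vir_z ^^ i) v))"

definition center_ann ::
  "(complex \<Rightarrow> 'v \<Rightarrow> 'v::ab_group_add) \<Rightarrow> (virasoro \<Rightarrow> 'v \<Rightarrow> 'v) \<Rightarrow> 'v \<Rightarrow> complex poly set" where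
  "center_ann scale act v = {u. center_act scale act u v = 0}"

definition vir_Hom ::
  "(complex \<Rightarrow> 'v \<Rightarrow> 'v::ab_group_add) \<Rightarrow> (virasoro \<Rightarrow> 'v \<Rightarrow> 'v) \<Rightarrow>
   (complex \<Rightarrow> 'w \<Rightarrow> 'w::ab_group_add) \<Rightarrow> (virasoro \<Rightarrow> 'w \<Rightarrow> 'w) \<Rightarrow> ('v \<Rightarrow> 'w) set" where
  "vir_Hom scaleV actV scaleW actW =
     {f. Vector_Spaces.linear scaleV scaleW f \<and> (\<forall>x v. f (actV x v) = actW x (f v))}"


section \<open>Quotients of the polynomial ring and isomorphisms of vector spaces\<close>

definition principal_ideal :: "complex poly \<Rightarrow> complex poly set" where
  "principal_ideal p = {p * r | r. True}"

definition residue_class :: "complex poly set \<Rightarrow> complex poly \<Rightarrow> complex poly set" where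
  "residue_class I s = {s + r | r. r \<in> I}"

definition poly_quotient :: "complex poly set \<Rightarrow> complex poly set set" where
  "poly_quotient I = {residue_class I s | s. True}"

definition quotient_add ::
  "complex poly set \<Rightarrow> complex poly set \<Rightarrow> complex poly set \<Rightarrow> complex poly set" where
  "quotient_add I A B = (\<Union>a\<in>A. \<Union>b\<in>B. residue_class I (a + b))"

definition quotient_scale ::
  "complex poly set \<Rightarrow> complex \<Rightarrow> complex poly set \<Rightarrow> complex poly set" where
  "quotient_scale I c A = (\<Union>a\<in>A. residue_class I (smult c a))"

lemma quotient_add_residue_class:
  "quotient_add (principal_ideal p) (residue_class (principal_ideal p) s)
     (residue_class (principal_ideal p) t) = residue_class (principal_ideal p) (s + t)"
  (is "?L = ?R")
proof
  show "?L \<subseteq> ?R"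
  proof
    fix u assume "u \<in> ?L"
    then obtain a b c where "u = s + p * a + (t + p * b) + p * c"
      unfolding quotient_add_def residue_class_def principal_ideal_def by auto
    then have "u = s + t + p * (a + b + c)" by (simp add: algebra_simps)
    then show "u \<in> ?R" unfolding residue_class_def principal_ideal_def by blast
  qed
  show "?R \<subseteq> ?L"
  proof -
    have "s \<in> residue_class (principal_ideal p) s" for s
      unfolding residue_class_def principal_ideal_def by (auto intro: exI[of _ 0])
    then show ?thesis unfolding quotient_add_def by blast
  qed
qed

lemma quotient_scale_residue_class:
  "quotient_scale (principal_ideal p) c (residue_class (principal_ideal p) s) =
     residue_class (principal_ideal p) (smult c s)"
proof -
  have "smult c (s + p * a) + p * b = smult c s + p * (smult c a + b)" for a b
    by (simp add: algebra_simps smult_add_right)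
  moreover have "smult c s + p * b = smult c (s + p * 0) + p * b" for b
    by simp
  ultimately show ?thesis
    unfolding quotient_scale_def residue_class_def principal_ideal_def by blast
qed

text \<open>\<open>F\<close> is an isomorphism of complex vector spaces from the carrier \<open>A\<close> (with the given addition
  and scalar multiplication) onto the carrier \<open>B\<close>.\<close>

definition vs_isomorphism ::
  "'a set \<Rightarrow> ('a \<Rightarrow> 'a \<Rightarrow> 'a) \<Rightarrow> (complex \<Rightarrow> 'a \<Rightarrow> 'a) \<Rightarrow>
   'b set \<Rightarrow> ('b \<Rightarrow> 'b \<Rightarrow> 'b) \<Rightarrow> (complex \<Rightarrow> 'b \<Rightarrow> 'b) \<Rightarrow> ('a \<Rightarrow> 'b) \<Rightarrow> bool" where
  "vs_isomorphism A addA scaleA B addB scaleB F \<longleftrightarrow>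
     bij_betw F A B \<and>
     (\<forall>x\<in>A. \<forall>y\<in>A. F (addA x y) = addB (F x) (F y)) \<and>
     (\<forall>c. \<forall>x\<in>A. F (scaleA c x) = scaleB c (F x))"

end

theory Submission
  imports Defs "HOL-Library.Product_Plus"
begin

text \<open>A homomorphism \<open>f\<close> on \<open>V = U(\<gg>) v\<close> is determined by \<open>f v\<close>, which is a Whittaker vector of
  \<open>W = U(\<gg>) w\<close> killed by \<open>p(z)\<close>. So the theorem rests on two points: the Whittaker vectors of \<open>W\<close>
  are the vectors \<open>r(z) w\<close> and nothing else, and every \<open>r(z) w\<close> killed by \<open>p(z)\<close> is the image of
  \<open>v\<close> under some homomorphism. The rest is arithmetic in \<open>\<complex>[z]\<close>: \<open>p r\<close> is divisible by \<open>q\<close> exactly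
  if \<open>r\<close> is a multiple of \<open>q / gcd p q\<close>.

  Both points come from a filtration of \<open>U(\<gg>) w\<close>. Since \<open>d\<^sub>n\<close> for \<open>n \<ge> 3\<close> is a commutator in \<open>\<nn>\<^sup>+\<close>, there is an
  index \<open>e\<close> (namely 1 or 2) with \<open>\<psi>(d\<^sub>e) \<noteq> 0\<close> and \<open>\<psi>(d\<^sub>n) = 0\<close> for \<open>n > e\<close>. The filtration gives
  \<open>w\<close> and \<open>z\<close> the degree 0 and \<open>d\<^sub>-\<^sub>j\<close>, for \<open>j \<ge> 0\<close>, the degree \<open>2 j + 1\<close>. The associated graded module
  is generated by \<open>w\<close> over the polynomial ring \<open>\<complex>[z, x\<^sub>0, x\<^sub>1, \<dots>]\<close>, where \<open>x\<^sub>j\<close> is the symbol of \<open>d\<^sub>-\<^sub>j\<close>.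
  For \<open>n \<ge> 1\<close> the operator \<open>d\<^sub>n - \<psi>(d\<^sub>n)\<close> lowers the degree (lemma \<open>fil_N\<close>), and the symbol of
  \<open>d\<^sub>k\<^sub>+\<^sub>e - \<psi>(d\<^sub>k\<^sub>+\<^sub>e)\<close> is \<open>(2 k + e) \<psi>(d\<^sub>e) \<partial>/\<partial>x\<^sub>k\<close>. Two consequences carry the proof.

  First, the Euler operator \<open>\<Sum>\<^sub>k (2 k + 1) x\<^sub>k \<partial>/\<partial>x\<^sub>k\<close> of the graded module lifts to
  \<open>\<Sum>\<^sub>k c\<^sub>k d\<^sub>-\<^sub>k (d\<^sub>k\<^sub>+\<^sub>e - \<psi>(d\<^sub>k\<^sub>+\<^sub>e))\<close>. It acts on degree \<open>m\<close> as \<open>m\<close> up to lower degree (lemma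
  \<open>fil_euler\<close>), but it kills every Whittaker vector. Hence a Whittaker vector of degree at most
  \<open>m \<ge> 1\<close> already has degree at most \<open>m - 1\<close>, and finally degree 0, that is, it lies in \<open>\<complex>[z] w\<close>
  (lemma \<open>whittaker_vectors_of_cyclic\<close>).

  Second, a nonzero vector of least degree in a submodule is a Whittaker vector, so every nonzero
  submodule of \<open>U(\<gg>) w\<close> contains some \<open>r(z) w \<noteq> 0\<close> (lemma \<open>submodule_meets_center_orbit\<close>). This is
  applied to the submodule of \<open>V \<times> W\<close> generated by \<open>(v, w')\<close>, where \<open>w'\<close> is a Whittaker vector killed by
  the annihilator of \<open>v\<close>. It meets \<open>0 \<times> W\<close> trivially, since otherwise some \<open>(r(z) v, r(z) w')\<close> would have
  \<open>r(z) v = 0\<close> and \<open>r(z) w' \<noteq> 0\<close>; so it is the graph of a homomorphism with \<open>v \<mapsto> w'\<close> (lemma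
  \<open>Hom_extending\<close>).

  Finite length enters to ensure \<open>q \<noteq> 0\<close> (lemma \<open>center_ann_nonzero\<close>): otherwise the formula
  would send every class to the zero homomorphism.\<close>

section \<open>Virasoro modules and the action of the centre\<close>

locale virasoro_module = lie_module vir_scale vir_bracket scale act
  for scale :: "complex \<Rightarrow> 'v::ab_group_add \<Rightarrow> 'v" and act :: "virasoro \<Rightarrow> 'v \<Rightarrow> 'v"
begin

abbreviation D :: "int \<Rightarrow> 'v \<Rightarrow> 'v" where "D n \<equiv> act (vir_d n)"

abbreviation Z :: "'v \<Rightarrow> 'v" where "Z \<equiv> act vir_z"

abbreviation C :: "complex poly \<Rightarrow> 'v \<Rightarrow> 'v" where "C \<equiv> center_act scale act"

lemma act_zero_right [simp]: "act x 0 = 0"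
  using act_add_right[of x 0 0] by simp

lemma act_zero_left [simp]: "act 0 v = 0"
  using act_add_left[of 0 0 v] by simp

lemma act_minus_right: "act x (- u) = - act x u"
  using act_add_right[of x u "- u"] by (simp add: minus_unique)

lemma act_diff_right: "act x (u - v) = act x u - act x v"
  using act_add_right[of x u "- v"] by (simp add: act_minus_right)

lemma act_sum_right: "act x (\<Sum>i\<in>A. f i) = (\<Sum>i\<in>A. act x (f i))"
  by (induction A rule: infinite_finite_induct) (auto simp: act_add_right)

lemma act_Z: "act x (Z v) = Z (act x v)"
  using act_bracket[of x vir_z v] by simp

lemma D_commute:
  "D n (D j v) = D j (D n v) + scale (of_int (n - j)) (D (n + j) v)
     + (if j = - n then scale (of_int (n ^ 3 - n) / 12) (Z v) else 0)"
proof -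
  have "D n (D j v) = D j (D n v) + act (vir_bracket (vir_d n) (vir_d j)) v"
    by (simp add: act_bracket)
  then show ?thesis
    by (simp add: vir_bracket_d act_add_left act_scale_left add.assoc)
qed

lemma center_act_altdef:
  assumes "Polynomial.degree p \<le> n"
  shows "C p v = (\<Sum>i\<le>n. scale (Polynomial.coeff p i) ((Z ^^ i) v))"
  unfolding center_act_def using assms
  by (intro sum.mono_neutral_left) (auto simp: coeff_eq_0)

lemma center_act_0 [simp]: "C 0 v = 0"
  by (simp add: center_act_def)

lemma center_act_pCons: "C (pCons a p) v = scale a v + Z (C p v)"
proof -
  let ?n = "Polynomial.degree p"
  have "C (pCons a p) v = (\<Sum>i\<le>Suc ?n. scale (Polynomial.coeff (pCons a p) i) ((Z ^^ i) v))"
    by (rule center_act_altdef) (rule degree_pCons_le)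
  also have "\<dots> = scale a v + (\<Sum>i\<le>?n. scale (Polynomial.coeff p i) (Z ((Z ^^ i) v)))"
    by (subst sum.atMost_Suc_shift) simp
  finally show ?thesis
    by (simp add: center_act_def act_sum_right act_scale_right)
qed

lemma center_act_1 [simp]: "C 1 v = v"
  by (simp add: center_act_def)

lemma center_act_scale_right: "C p (scale c v) = scale c (C p v)"
  by (induction p)
    (simp_all add: center_act_pCons act_scale_right V.scale_right_distrib mult.commute)

lemma act_center_act: "act x (C p v) = C p (act x v)"
  by (induction p) (simp_all add: center_act_pCons act_add_right act_scale_right act_Z)

lemma center_act_add: "C (p + q) v = C p v + C q v"
proof (induction p arbitrary: q)
  case (pCons a p)
  obtain b q' where "q = pCons b q'" by (cases q)
  with pCons(2)[of q'] show ?case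
    by (simp add: center_act_pCons act_add_right V.scale_left_distrib)
qed simp

lemma center_act_smult: "C (smult c p) v = scale c (C p v)"
  by (induction p) (simp_all add: center_act_pCons act_scale_right V.scale_right_distrib)

lemma center_act_mult: "C (p * q) v = C p (C q v)"
  by (induction p) (simp_all add: center_act_pCons center_act_add center_act_smult)

lemma center_act_diff: "C (p - q) v = C p v - C q v"
  using center_act_add[of "p - q" q v] by simp

lemma submodule_center_act:
  assumes "vir_submodule scale act S" "v \<in> S"
  shows "C p v \<in> S"
proof (induction p)
  case 0
  show ?case using assms by (simp add: stable_subspace_def V.subspace_0)
next
  case (pCons a p)
  then show ?case using assms
    by (simp add: center_act_pCons stable_subspace_def V.subspace_add V.subspace_scale)
qed

lemma generated_by_least:
  "vir_submodule scale act S \<Longrightarrow> v \<in> S \<Longrightarrow> generated_by scale act UNIV v \<subseteq> S"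
  by (auto simp: generated_by_def)

lemma generated_by_generator: "v \<in> generated_by scale act A v"
  by (simp add: generated_by_def)

lemma submodule_generated_by: "vir_submodule scale act (generated_by scale act UNIV v)"
  unfolding generated_by_def stable_subspace_def
  by (auto intro!: V.subspaceI intro: V.subspace_0 V.subspace_add V.subspace_scale)

lemma submodule_D_Z_I:
  assumes "V.subspace S" "\<And>n u. u \<in> S \<Longrightarrow> D n u \<in> S" "\<And>u. u \<in> S \<Longrightarrow> Z u \<in> S"
  shows "vir_submodule scale act S"
proof -
  have "\<forall>u\<in>S. act x u \<in> S" for x
    by (induction x rule: vir_induct)
      (auto simp: act_add_left act_scale_left assms V.subspace_add V.subspace_scale)
  then show ?thesis using assms(1) by (simp add: stable_subspace_def)
qed

end


section \<open>The filtration of a module generated by a Whittaker vector\<close>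

locale whittaker_generator = virasoro_module scale act
  for scale :: "complex \<Rightarrow> 'v::ab_group_add \<Rightarrow> 'v" and act :: "virasoro \<Rightarrow> 'v \<Rightarrow> 'v" +
  fixes \<chi> :: "int \<Rightarrow> complex" and e :: int and w :: 'v
  assumes e_ge_1: "e \<ge> 1" and chi_e: "\<chi> e \<noteq> 0" and chi_above_e: "n > e \<Longrightarrow> \<chi> n = 0"
    and D_w: "n \<ge> 1 \<Longrightarrow> D n w = scale (\<chi> n) w"
begin

text \<open>\<open>fil m x\<close> says that \<open>x\<close> has degree at most \<open>m\<close>, where \<open>d\<^sub>-\<^sub>j\<close> with \<open>j \<ge> 0\<close> has degree \<open>2 j + 1\<close>.
  The degrees must be such that \<open>d\<^sub>k\<^sub>+\<^sub>e - \<chi> (k + e)\<close> lowers by exactly the degree of \<open>d\<^sub>-\<^sub>k\<close>, through the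
  term in which the bracket with \<open>d\<^sub>-\<^sub>k\<close> produces \<open>d\<^sub>e\<close>. Brackets that produce some \<open>d\<^sub>-\<^sub>i\<close> instead lower the
  degree by \<open>2 (k + e)\<close>; this has to be strictly more than the degree of \<open>d\<^sub>-\<^sub>k\<close>, which the choice
  \<open>2 k + 1\<close> ensures even for \<open>e = 1\<close>. Degrees are integers so that negative degree makes sense: there
  the filtration is zero.\<close>

inductive fil :: "int \<Rightarrow> 'v \<Rightarrow> bool" where
  fil_w: "fil 0 w"
| fil_zero: "fil m 0"
| fil_add: "fil m x \<Longrightarrow> fil m y \<Longrightarrow> fil m (x + y)"
| fil_scale: "fil m x \<Longrightarrow> fil m (scale c x)"
| fil_Suc: "fil m x \<Longrightarrow> fil (m + 1) x"
| fil_Z: "fil m x \<Longrightarrow> fil m (Z x)"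
| fil_D: "fil m x \<Longrightarrow> j \<ge> 0 \<Longrightarrow> fil (m + 2 * j + 1) (D (- j) x)"

lemma fil_mono:
  assumes "fil m x" "m \<le> n"
  shows "fil n x"
  using assms(2,1) by (induction n rule: int_ge_induct) (auto intro: fil_Suc)

lemma fil_minus: "fil m x \<Longrightarrow> fil m (- x)"
  using fil_scale[of m x "-1"] by simp

lemma fil_diff: "fil m x \<Longrightarrow> fil m y \<Longrightarrow> fil m (x - y)"
  using fil_add[of m x "- y"] fil_minus by simp

lemma fil_sum: "(\<And>i. i \<in> A \<Longrightarrow> fil m (f i)) \<Longrightarrow> fil m (\<Sum>i\<in>A. f i)"
  by (induction A rule: infinite_finite_induct) (auto intro: fil_add fil_zero)

lemma fil_D_le:
  assumes "fil m x" "j \<ge> 0" "m + 2 * j + 1 \<le> n"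
  shows "fil n (D (- j) x)"
  using fil_D[OF assms(1,2)] assms(3) by (rule fil_mono)

lemma fil_negative: "fil m x \<Longrightarrow> m < 0 \<Longrightarrow> x = 0"
  by (induction rule: fil.induct) auto

lemma fil_nonpositive: "fil m x \<Longrightarrow> m \<le> 0 \<Longrightarrow> \<exists>p. x = C p w"
proof (induction rule: fil.induct)
  case fil_w
  show ?case by (intro exI[of _ 1]) simp
next
  case (fil_zero m)
  show ?case by (intro exI[of _ 0]) simp
next
  case (fil_add m x y)
  then show ?case by (metis center_act_add)
next
  case (fil_scale m x c)
  then show ?case by (metis center_act_smult)
next
  case (fil_Z m x)
  then obtain p where "x = C p w" by auto
  then show ?case by (intro exI[of _ "pCons 0 p"]) (simp add: center_act_pCons)
next
  case (fil_D m x j)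
  then have "x = 0" by (intro fil_negative[of m]) auto
  then show ?case by (intro exI[of _ 0]) simp
qed auto

text \<open>A vector is a Whittaker vector if and only if all \<open>N n\<close> with \<open>n \<ge> 1\<close> kill it.\<close>

definition N :: "int \<Rightarrow> 'v \<Rightarrow> 'v" where "N n x = D n x - scale (\<chi> n) x"

lemma N_zero [simp]: "N n 0 = 0"
  by (simp add: N_def)

lemma N_add: "N n (x + y) = N n x + N n y"
  by (simp add: N_def act_add_right V.scale_right_distrib)

lemma N_scale: "N n (scale c x) = scale c (N n x)"
  by (simp add: N_def act_scale_right V.scale_right_diff_distrib mult.commute)

lemma N_Z: "N n (Z x) = Z (N n x)"
  by (simp add: N_def act_Z act_diff_right act_scale_right)

lemma N_w [simp]: "n \<ge> 1 \<Longrightarrow> N n w = 0"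
  by (simp add: N_def D_w)

lemma N_D: "N n (D (- j) x) = D (- j) (N n x) + scale (of_int (n + j)) (D (n - j) x)
     + (if n = j then scale (of_int (n ^ 3 - n) / 12) (Z x) else 0)"
  using D_commute[of n "- j" x]
  by (simp add: N_def act_diff_right act_scale_right algebra_simps)

text \<open>The general bound 1 makes \<open>N n\<close> lower the degree at all. The sharper bound for \<open>n > e\<close> comes from
  \<open>\<chi> n = 0\<close>: a commutator \<open>[d\<^sub>n, d\<^sub>-\<^sub>j]\<close> with \<open>n - j > e\<close> removes \<open>d\<^sub>-\<^sub>j\<close> and leaves an operator that lowers the
  degree again, so at least \<open>n - e\<close> units of index are lost before a nonzero value of \<open>\<chi>\<close> is met.\<close>

lemma fil_N: "fil m x \<Longrightarrow> n \<ge> 1 \<Longrightarrow> fil (m - 2 * max (n - e) 0 - 1) (N n x)"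
proof (induction arbitrary: n rule: fil.induct)
  case fil_w
  then show ?case by (simp add: fil_zero)
next
  case (fil_zero m)
  show ?case by (simp add: fil.fil_zero)
next
  case (fil_add m x y)
  then show ?case by (simp add: N_add fil.fil_add)
next
  case (fil_scale m x c)
  then show ?case by (simp add: N_scale fil.fil_scale)
next
  case (fil_Suc m x)
  show ?case by (rule fil_mono[OF fil_Suc(2)[OF fil_Suc(3)]]) simp
next
  case (fil_Z m x)
  then show ?case by (simp add: N_Z fil.fil_Z)
next
  case (fil_D m x j)
  let ?m = "m + 2 * j + 1 - 2 * max (n - e) 0 - 1"
  have 1: "fil ?m (D (- j) (N n x))"
    by (rule fil_D_le[OF fil_D(3)[OF fil_D(4)] fil_D(2)]) simp
  have 2: "fil ?m (D (n - j) x)"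
  proof (cases "n \<le> j")
    case True
    have "fil ?m (D (- (j - n)) x)"
      by (rule fil_D_le[OF fil_D(1)]) (use True fil_D(4) e_ge_1 in \<open>auto simp: max_def\<close>)
    then show ?thesis by simp
  next
    case False
    have "fil ?m (N (n - j) x)"
      by (rule fil_mono[OF fil_D(3)]) (use False fil_D(2) in \<open>auto simp: max_def\<close>)
    moreover have "fil ?m (scale (\<chi> (n - j)) x)"
    proof (cases "n - j > e")
      case True
      then show ?thesis by (simp add: chi_above_e fil_zero)
    next
      case False
      then show ?thesis
        using fil_D(2) by (intro fil_mono[OF fil_scale[OF fil_D(1)]]) (auto simp: max_def)
    qed
    ultimately show ?thesis
      using fil_add[of ?m "N (n - j) x" "scale (\<chi> (n - j)) x"] by (simp add: N_def)
  qed
  have 3: "fil ?m (Z x)" if "n = j"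
    by (rule fil_mono[OF fil_Z[OF fil_D(1)]]) (use that fil_D(4) e_ge_1 in \<open>auto simp: max_def\<close>)
  show ?case
    unfolding N_D using 1 2 3 by (auto intro!: fil_add fil_scale fil_zero)
qed

lemma fil_N_minus_1: "fil m x \<Longrightarrow> n \<ge> 1 \<Longrightarrow> fil (m - 1) (N n x)"
  by (rule fil_mono[OF fil_N]) (auto simp: max_def)

lemma fil_D_pos: "fil m x \<Longrightarrow> n \<ge> 1 \<Longrightarrow> fil m (D n x)"
  using fil_add[of m "N n x" "scale (\<chi> n) x"] fil_mono[OF fil_N_minus_1[of m x n], of m]
    fil_scale[of m x "\<chi> n"]
  by (simp add: N_def)

lemma generated_by_w_fil:
  assumes "x \<in> generated_by scale act UNIV w"
  obtains m :: nat where "fil (int m) x"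
proof -
  let ?S = "{x. \<exists>m. fil m x}"
  have "fil (max m n) (x + y)" if "fil m x" "fil n y" for m n x y
    using that by (auto intro!: fil_add elim: fil_mono)
  then have "V.subspace ?S"
    by (intro V.subspaceI) (blast intro: fil_zero fil_scale)+
  moreover have "\<exists>m'. fil m' (D n u)" if "fil m u" for m n u
    using fil_D_pos[OF that, of n] fil_D[OF that, of "- n"]
    by (cases "n \<ge> 1") auto
  ultimately have "vir_submodule scale act ?S"
    by (intro submodule_D_Z_I) (auto intro: fil_Z)
  then have "generated_by scale act UNIV w \<subseteq> ?S"
    by (rule generated_by_least) (auto intro: fil_w)
  with assms obtain m where "fil m x" by auto
  then have "fil (int (nat m)) x" by (rule fil_mono) auto
  then show ?thesis by (rule that)
qed

section \<open>Whittaker vectors and the Euler operator\<close>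

definition T :: "int \<Rightarrow> 'v \<Rightarrow> 'v" where "T k x = D (- k) (N (k + e) x)"

text \<open>On symbols, \<open>T k\<close> is \<open>(2 k + e) \<chi>(e) x\<^sub>k \<partial>/\<partial>x\<^sub>k\<close>, and the lemma is its commutator with the
  multiplication by \<open>x\<^sub>j\<close>.\<close>

lemma fil_T_commutator:
  assumes "fil m x" "k \<ge> 0" "j \<ge> 0"
  shows "fil (m + 2 * j) (T k (D (- j) x) - D (- j) (T k x)
     - (if k = j then scale (of_int (2 * j + e) * \<chi> e) (D (- j) x) else 0))"
proof -
  let ?y = "N (k + e) x" and ?m = "m + 2 * j"
  let ?ze = "if j = - k then scale (of_int ((- k) ^ 3 - (- k)) / 12) (Z ?y) else 0"
  let ?c = "if k + e = j then scale (of_int ((k + e) ^ 3 - (k + e)) / 12) (D (- k) (Z x)) else 0"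
  have y: "fil (m - 2 * k - 1) ?y"
    using fil_N[OF assms(1), of "k + e"] assms(2) e_ge_1 by simp
  \<comment> \<open>The symbols of \<open>d\<^sub>-\<^sub>k\<close> and \<open>d\<^sub>-\<^sub>j\<close> commute: \<open>d\<^sub>-\<^sub>k\<^sub>-\<^sub>j\<close> has one degree less than their product.\<close>
  have 1: "fil ?m (D (- k) (D (- j) ?y) - D (- j) (D (- k) ?y))"
  proof -
    have "fil ?m (D (- (k + j)) ?y)"
      by (rule fil_D_le[OF y]) (use assms in auto)
    moreover have "fil ?m (Z ?y)"
      by (rule fil_mono[OF fil_Z[OF y]]) (use assms in auto)
    ultimately show ?thesis
      by (subst D_commute[of "- k" "- j"])
        (auto intro!: fil_add fil_scale fil_zero)
  qed
  \<comment> \<open>The bracket of \<open>d\<^sub>k\<^sub>+\<^sub>e\<close> with \<open>d\<^sub>-\<^sub>j\<close> is a multiple of \<open>d\<^sub>e\<close> if \<open>k = j\<close>; otherwise it loses degree.\<close>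
  have 2: "fil ?m (scale (of_int (k + e + j)) (D (- k) (D (k + e - j) x))
     - (if k = j then scale (of_int (2 * j + e) * \<chi> e) (D (- j) x) else 0))"
  proof -
    consider "k = j" | "k > j" | "k < j" "k + e - j \<ge> 1" | "k < j" "k + e - j \<le> 0" by linarith
    then show ?thesis
    proof cases
      case 1
      have "fil ?m (D (- j) (N e x))"
        by (rule fil_D_le[OF fil_N_minus_1[OF assms(1)]]) (use assms e_ge_1 in auto)
      then have "fil ?m (scale (of_int (2 * j + e)) (D (- j) (N e x)))"
        by (rule fil_scale)
      then show ?thesis
        using 1 by (simp add: N_def act_diff_right act_scale_right V.scale_right_diff_distrib
            algebra_simps)
    next
      case 2
      have "N (k + e - j) x = D (k + e - j) x"
        using 2 by (simp add: N_def chi_above_e)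
      then have "fil (m - 2 * (k - j) - 1) (D (k + e - j) x)"
        using fil_N[OF assms(1), of "k + e - j"] 2 e_ge_1 by simp
      then have "fil ?m (D (- k) (D (k + e - j) x))"
        by (rule fil_D_le) (use assms in auto)
      then show ?thesis using 2 by (auto intro: fil_scale)
    next
      case 3
      have "fil ?m (D (- k) (D (k + e - j) x))"
        by (rule fil_D_le[OF fil_D_pos[OF assms(1)]]) (use assms 3 in auto)
      then show ?thesis using 3 by (auto intro: fil_scale)
    next
      case 4
      have "fil (m + 2 * (j - k - e) + 1) (D (- (j - k - e)) x)"
        by (rule fil_D[OF assms(1)]) (use 4 in auto)
      then have "fil (m + 2 * (j - k - e) + 1) (D (k + e - j) x)"
        by (simp add: algebra_simps)
      then have "fil ?m (D (- k) (D (k + e - j) x))"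
        by (rule fil_D_le) (use assms e_ge_1 in auto)
      then show ?thesis using 4 by (auto intro: fil_scale)
    qed
  qed
  have 3: "fil ?m ?c"
  proof -
    have "fil ?m (D (- k) (Z x))" if "k + e = j"
      by (rule fil_D_le[OF fil_Z[OF assms(1)]]) (use assms e_ge_1 that in auto)
    then show ?thesis by (auto intro: fil_scale fil_zero)
  qed
  have eq: "T k (D (- j) x) - D (- j) (T k x)
     - (if k = j then scale (of_int (2 * j + e) * \<chi> e) (D (- j) x) else 0) =
     (D (- k) (D (- j) ?y) - D (- j) (D (- k) ?y)) +
     (scale (of_int (k + e + j)) (D (- k) (D (k + e - j) x))
     - (if k = j then scale (of_int (2 * j + e) * \<chi> e) (D (- j) x) else 0)) + ?c"
    unfolding T_def N_D by (simp add: act_add_right act_scale_right)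
  show ?thesis unfolding eq by (rule fil_add[OF fil_add[OF 1 2] 3])
qed

text \<open>The factor \<open>(2 k + e) \<chi>(e)\<close> of the symbol of \<open>T k\<close> is replaced by the degree of \<open>x\<^sub>k\<close>.\<close>

definition euler_coeff :: "int \<Rightarrow> complex" where
  "euler_coeff k = of_int (2 * k + 1) / (of_int (2 * k + e) * \<chi> e)"

text \<open>The sum over all \<open>k\<close> is truncated at \<open>M\<close>; on degree at most \<open>M\<close> the missing terms would not matter,
  as a variable \<open>x\<^sub>k\<close> with \<open>k \<ge> M\<close> has a larger degree.\<close>

definition euler :: "int \<Rightarrow> 'v \<Rightarrow> 'v" where
  "euler M x = (\<Sum>k\<in>{0..<M}. scale (euler_coeff k) (T k x))"

lemma T_add: "T k (x + y) = T k x + T k y"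
  by (simp add: T_def N_add act_add_right)

lemma T_scale: "T k (scale c x) = scale c (T k x)"
  by (simp add: T_def N_scale act_scale_right)

lemma T_Z: "T k (Z x) = Z (T k x)"
  by (simp add: T_def N_Z act_Z)

lemma euler_zero [simp]: "euler M 0 = 0"
  by (simp add: euler_def T_def)

lemma euler_add: "euler M (x + y) = euler M x + euler M y"
  by (simp add: euler_def T_add V.scale_right_distrib sum.distrib)

lemma euler_scale: "euler M (scale c x) = scale c (euler M x)"
  by (simp add: euler_def T_scale V.scale_sum_right mult.commute)

lemma euler_Z: "euler M (Z x) = Z (euler M x)"
  by (simp add: euler_def T_Z act_sum_right act_scale_right)

text \<open>Euler's identity for weighted homogeneous polynomials, up to terms of lower degree.\<close>

lemma fil_euler: "fil m x \<Longrightarrow> m \<le> M \<Longrightarrow> fil (m - 1) (euler M x - scale (of_int m) x)"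
proof (induction rule: fil.induct)
  case fil_w
  have "T k w = 0" if "k \<ge> 0" for k
    using that e_ge_1 by (simp add: T_def)
  then have "euler M w = 0" by (simp add: euler_def)
  then show ?case by (simp add: fil_zero)
next
  case (fil_zero m)
  show ?case by (simp add: fil.fil_zero)
next
  case (fil_add m x y)
  have "euler M (x + y) - scale (of_int m) (x + y) =
    (euler M x - scale (of_int m) x) + (euler M y - scale (of_int m) y)"
    by (simp add: euler_add V.scale_right_distrib)
  with fil_add show ?case by (simp add: fil.fil_add)
next
  case (fil_scale m x c)
  have "euler M (scale c x) - scale (of_int m) (scale c x) =
    scale c (euler M x - scale (of_int m) x)"
    by (simp add: euler_scale V.scale_right_diff_distrib mult.commute)
  with fil_scale show ?case by (simp add: fil.fil_scale)
next
  case (fil_Suc m x)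
  have eq: "euler M x - scale (of_int (m + 1)) x = (euler M x - scale (of_int m) x) - x"
    by (simp add: V.scale_left_distrib)
  have "fil m (euler M x - scale (of_int m) x)"
    by (rule fil_mono[OF fil_Suc(2)]) (use fil_Suc(3) in auto)
  then have "fil m (euler M x - scale (of_int (m + 1)) x)"
    unfolding eq using fil_Suc(1) by (rule fil_diff)
  then show ?case by simp
next
  case (fil_Z m x)
  have "euler M (Z x) - scale (of_int m) (Z x) = Z (euler M x - scale (of_int m) x)"
    by (simp add: euler_Z act_diff_right act_scale_right)
  with fil_Z show ?case by (simp add: fil.fil_Z)
next
  case (fil_D m x j)
  show ?case
  proof (cases "j < M")
    case False
    then have "x = 0" using fil_D by (intro fil_negative[of m]) auto
    then show ?thesis by (simp add: fil_zero)
  next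
    case True
    let ?d = "\<lambda>k. if k = j then scale (of_int (2 * j + e) * \<chi> e) (D (- j) x) else 0"
    have nz: "of_int (2 * j + e) \<noteq> (0 :: complex)"
      using fil_D(2) e_ge_1 by (subst of_int_eq_0_iff) linarith
    have "(\<Sum>k\<in>{0..<M}. scale (euler_coeff k) (?d k)) =
        (\<Sum>k\<in>{0..<M}. if k = j then scale (of_int (2 * j + 1)) (D (- j) x) else 0)"
      using nz chi_e by (intro sum.cong refl) (auto simp: euler_coeff_def simp del: of_int_add)
    then have s: "(\<Sum>k\<in>{0..<M}. scale (euler_coeff k) (?d k)) = scale (of_int (2 * j + 1)) (D (- j) x)"
      using True fil_D(2) by simp
    have 1: "fil (m + 2 * j) (D (- j) (euler M x - scale (of_int m) x))"
      by (rule fil_D_le[OF fil_D(3)]) (use fil_D in auto)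
    have 2: "fil (m + 2 * j)
        (\<Sum>k\<in>{0..<M}. scale (euler_coeff k) (T k (D (- j) x) - D (- j) (T k x) - ?d k))"
      using fil_D by (intro fil_sum fil_scale fil_T_commutator) auto
    have eq: "(\<Sum>k\<in>{0..<M}. scale (euler_coeff k) (T k (D (- j) x) - D (- j) (T k x) - ?d k)) =
        euler M (D (- j) x) - D (- j) (euler M x) - scale (of_int (2 * j + 1)) (D (- j) x)"
      by (simp only: V.scale_right_diff_distrib sum_subtractf s)
        (simp add: euler_def act_sum_right act_scale_right)
    show ?thesis
      using fil_add[OF 1 2[unfolded eq]]
      by (simp add: act_diff_right act_scale_right V.scale_left_distrib algebra_simps)
  qed
qed

text \<open>The Euler operator kills \<open>x\<close>, so Euler's identity puts \<open>m x\<close>, and for \<open>m \<noteq> 0\<close> also \<open>x\<close>, one step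
  lower in the filtration. The descent ends in degree 0, which is \<open>\<complex>[z] w\<close>.\<close>

lemma whittaker_vectors_of_cyclic:
  assumes "x \<in> generated_by scale act UNIV w" and "\<And>n. n \<ge> 1 \<Longrightarrow> D n x = scale (\<chi> n) x"
  obtains p where "x = C p w"
proof -
  obtain m where "fil (int m) x"
    using assms(1) by (rule generated_by_w_fil)
  moreover have "fil 0 x" if "fil (int m) x" for m
    using that
  proof (induction m)
    case (Suc m)
    let ?c = "of_int (int (Suc m)) :: complex"
    have "euler (int (Suc m)) x = 0"
      using assms(2) e_ge_1 by (simp add: euler_def T_def N_def)
    with fil_euler[OF Suc(2) order.refl]
    have "fil (int (Suc m) - 1) (- scale ?c x)" by (simp only: diff_0)
    then have "fil (int m) (scale ?c x)" using fil_minus[of "int m" "- scale ?c x"] by simp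
    then have "fil (int m) (scale (inverse ?c) (scale ?c x))"
      by (rule fil_scale)
    moreover have "inverse ?c * ?c = 1"
      by (rule left_inverse) (simp only: of_int_of_nat_eq of_nat_eq_0_iff)
    ultimately have "fil (int m) x"
      by (simp only: V.scale_scale V.scale_one)
    then show ?case by (rule Suc(1))
  qed simp
  ultimately show ?thesis
    using fil_nonpositive[of 0 x] that by auto
qed

text \<open>The operators \<open>N n\<close> preserve \<open>K\<close> and lower the degree, so they kill a nonzero element of \<open>K\<close> of
  least degree; it is a Whittaker vector.\<close>

lemma submodule_meets_center_orbit:
  assumes "vir_submodule scale act K" "K \<subseteq> generated_by scale act UNIV w" "x \<in> K" "x \<noteq> 0"
  obtains p where "C p w \<in> K" "C p w \<noteq> 0"
proof -
  let ?P = "\<lambda>m :: nat. \<exists>x\<in>K. x \<noteq> 0 \<and> fil (int m) x"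
  have "\<exists>m. ?P m"
    using assms generated_by_w_fil[of x] by blast
  then obtain m where m: "?P m" and least: "\<And>m'. m' < m \<Longrightarrow> \<not> ?P m'"
    using exists_least_iff[of ?P] by blast
  from m obtain y where y: "y \<in> K" "y \<noteq> 0" "fil (int m) y" by blast
  have "N n y = 0" if "n \<ge> 1" for n
  proof (rule ccontr)
    assume nz: "N n y \<noteq> 0"
    have f: "fil (int m - 1) (N n y)" using y(3) that by (rule fil_N_minus_1)
    have "m \<noteq> 0"
    proof
      assume "m = 0"
      then show False using nz fil_negative[OF f] by simp
    qed
    then have "fil (int (m - 1)) (N n y)" using f by (simp add: of_nat_diff)
    moreover have "N n y \<in> K"
      using assms(1) y(1) unfolding N_def stable_subspace_def
      by (auto intro!: V.subspace_diff V.subspace_scale)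
    ultimately show False using least[of "m - 1"] nz \<open>m \<noteq> 0\<close> by auto
  qed
  then have "D n y = scale (\<chi> n) y" if "n \<ge> 1" for n using that by (simp add: N_def)
  then obtain p where "y = C p w"
    using whittaker_vectors_of_cyclic[of y] y(1) assms(2) by blast
  then show ?thesis using y that by blast
qed

end

section \<open>Characters of the positive part\<close>

lemma vir_d_nplus [intro]: "n \<ge> 1 \<Longrightarrow> vir_d n \<in> nplus"
  unfolding nplus_def by (intro vir_vs.span_base) auto

lemma nplus_induct [consumes 1, case_names zero add scale d]:
  assumes "x \<in> nplus" "P 0"
    and "\<And>x y. x \<in> nplus \<Longrightarrow> y \<in> nplus \<Longrightarrow> P x \<Longrightarrow> P y \<Longrightarrow> P (x + y)"
    and "\<And>c x. x \<in> nplus \<Longrightarrow> P x \<Longrightarrow> P (vir_scale c x)"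
    and "\<And>n. n \<ge> 1 \<Longrightarrow> P (vir_d n)"
  shows "P x"
proof -
  have "x \<in> nplus \<and> P x"
    using assms(1) unfolding nplus_def
  proof (rule vir_vs.span_induct)
    show "vir_vs.subspace {x. x \<in> vir_vs.span (vir_d ` {k. k > 0}) \<and> P x}"
      using assms(2-4)
      by (intro vir_vs.subspaceI)
        (auto simp: nplus_def intro: vir_vs.span_add vir_vs.span_scale vir_vs.span_zero)
  qed (use assms(5) in \<open>auto intro: vir_vs.span_base\<close>)
  then show ?thesis by simp
qed

text \<open>From \<open>[d\<^sub>n\<^sub>-\<^sub>1, d\<^sub>1] = (n - 2) d\<^sub>n\<close> a character vanishes on \<open>d\<^sub>n\<close> for \<open>n \<ge> 3\<close>, so \<open>e\<close> is 2 or 1.\<close>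

lemma nplus_character_leading_index:
  assumes "nplus_character \<psi>" "\<exists>x\<in>nplus. \<psi> x \<noteq> 0"
  obtains e :: int where "e \<ge> 1" "\<psi> (vir_d e) \<noteq> 0" "\<And>n. n > e \<Longrightarrow> \<psi> (vir_d n) = 0"
proof -
  have add: "\<psi> (x + y) = \<psi> x + \<psi> y" if "x \<in> nplus" "y \<in> nplus" for x y
    using assms(1) that by (simp add: nplus_character_def)
  have scale: "\<psi> (vir_scale c x) = c * \<psi> x" if "x \<in> nplus" for c x
    using assms(1) that by (simp add: nplus_character_def)
  have high: "\<psi> (vir_d n) = 0" if "n \<ge> 3" for n
  proof -
    have "\<psi> (vir_bracket (vir_d (n - 1)) (vir_d 1)) = 0"
      using assms(1) that by (simp add: nplus_character_def vir_d_nplus)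
    then have "of_int (n - 2) * \<psi> (vir_d n) = 0"
      using that by (simp add: vir_bracket_d scale vir_d_nplus del: of_int_diff)
    moreover have "of_int (n - 2) \<noteq> (0 :: complex)"
      using that by (subst of_int_eq_0_iff) linarith
    ultimately show ?thesis by simp
  qed
  have "\<psi> (vir_d 1) \<noteq> 0 \<or> \<psi> (vir_d 2) \<noteq> 0"
  proof (rule ccontr)
    assume low: "\<not> ?thesis"
    have "\<psi> (vir_d n) = 0" if "n \<ge> 1" for n
    proof -
      have "n = 1 \<or> n = 2 \<or> n \<ge> 3" using that by linarith
      then show ?thesis using low high by auto
    qed
    note low = this
    have zero: "\<psi> 0 = 0"
      using scale[of "vir_d 1" 0] by (simp add: vir_d_nplus)
    have "\<psi> x = 0" if "x \<in> nplus" for x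
      using that by (induction rule: nplus_induct) (auto simp: add scale low zero)
    with assms(2) show False by blast
  qed
  then consider "\<psi> (vir_d 2) \<noteq> 0" | "\<psi> (vir_d 1) \<noteq> 0" "\<psi> (vir_d 2) = 0" by blast
  then show ?thesis
  proof cases
    case 1
    then show ?thesis by (intro that[of 2]) (auto intro: high)
  next
    case 2
    have "\<psi> (vir_d n) = 0" if "n > 1" for n
      using 2(2) high[of n] that by (cases "n = 2") auto
    with 2(1) show ?thesis by (intro that[of 1]) auto
  qed
qed

lemma (in virasoro_module) whittaker_vector_iff:
  assumes "nplus_character \<psi>"
  shows "whittaker_vector \<psi> scale act w \<longleftrightarrow> (\<forall>n\<ge>1. D n w = scale (\<psi> (vir_d n)) w)"
proof
  assume "whittaker_vector \<psi> scale act w"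
  then show "\<forall>n\<ge>1. D n w = scale (\<psi> (vir_d n)) w"
    by (auto simp: whittaker_vector_def)
next
  assume *: "\<forall>n\<ge>1. D n w = scale (\<psi> (vir_d n)) w"
  have "act x w = scale (\<psi> x) w" if "x \<in> nplus" for x
    using that
  proof (induction rule: nplus_induct)
    case zero
    have "\<psi> (vir_scale 0 (vir_d 1)) = 0 * \<psi> (vir_d 1)"
      using assms vir_d_nplus[of 1] unfolding nplus_character_def by blast
    then show ?case by simp
  next
    case (add x y)
    then show ?case using assms
      by (simp add: nplus_character_def act_add_left V.scale_left_distrib)
  next
    case (scale c x)
    then show ?case using assms
      by (simp add: nplus_character_def act_scale_left)
  qed (use * in auto)
  then show "whittaker_vector \<psi> scale act w" by (simp add: whittaker_vector_def)
qed

lemma (in virasoro_module) whittaker_vector_center_act: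
  "whittaker_vector \<psi> scale act w \<Longrightarrow> whittaker_vector \<psi> scale act (C p w)"
  by (simp add: whittaker_vector_def act_center_act center_act_scale_right)

section \<open>Whittaker vectors, submodules and central annihilators\<close>

lemma (in virasoro_module) whittaker_vectors_in_generated:
  assumes "nplus_character \<psi>" "\<exists>x\<in>nplus. \<psi> x \<noteq> 0" "whittaker_vector \<psi> scale act w"
    and "whittaker_vector \<psi> scale act u" "u \<in> generated_by scale act UNIV w"
  obtains p where "u = C p w"
proof -
  obtain e :: int where e: "e \<ge> 1" "\<psi> (vir_d e) \<noteq> 0" "\<And>n. n > e \<Longrightarrow> \<psi> (vir_d n) = 0"
    using nplus_character_leading_index[OF assms(1,2)] by blast
  interpret whittaker_generator scale act "\<lambda>n. \<psi> (vir_d n)" e w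
    by unfold_locales (use e assms(3) in \<open>auto simp: whittaker_vector_iff[OF assms(1)]\<close>)
  show ?thesis
    using whittaker_vectors_of_cyclic[OF assms(5)] assms(4) that
    by (auto simp: whittaker_vector_iff[OF assms(1)])
qed

lemma (in virasoro_module) nonzero_submodule_meets_center_orbit:
  assumes "nplus_character \<psi>" "\<exists>x\<in>nplus. \<psi> x \<noteq> 0" "whittaker_vector \<psi> scale act w"
    and "vir_submodule scale act K" "K \<subseteq> generated_by scale act UNIV w" "x \<in> K" "x \<noteq> 0"
  obtains p where "C p w \<in> K" "C p w \<noteq> 0"
proof -
  obtain e :: int where e: "e \<ge> 1" "\<psi> (vir_d e) \<noteq> 0" "\<And>n. n > e \<Longrightarrow> \<psi> (vir_d n) = 0"
    using nplus_character_leading_index[OF assms(1,2)] by blast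
  interpret whittaker_generator scale act "\<lambda>n. \<psi> (vir_d n)" e w
    by unfold_locales (use e assms(3) in \<open>auto simp: whittaker_vector_iff[OF assms(1)]\<close>)
  show ?thesis
    using submodule_meets_center_orbit[OF assms(4-7)] that by blast
qed

text \<open>Suppose that \<open>\<complex>[z]\<close> acts faithfully on \<open>w\<close>. The simple submodule at the bottom of a composition
  series contains some \<open>r(z) w \<noteq> 0\<close>, and it is generated by \<open>z r(z) w\<close>, which is nonzero as well. The
  Whittaker vector \<open>r(z) w\<close> then has the form \<open>t(z) z r(z) w\<close>, so \<open>r = t z r\<close> in \<open>\<complex>[z]\<close>, which
  is impossible for \<open>r \<noteq> 0\<close>.\<close>

lemma (in virasoro_module) center_ann_nonzero:
  assumes psi: "nplus_character \<psi>" "\<exists>x\<in>nplus. \<psi> x \<noteq> 0"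
    and cyclic: "cyclic_whittaker_vector \<psi> scale act w" and "finite_length scale act"
  obtains p where "p \<noteq> 0" "C p w = 0"
proof (rule ccontr)
  assume "\<not> thesis"
  with that have faithful: "C p w = 0 \<Longrightarrow> p = 0" for p by blast
  have w: "whittaker_vector \<psi> scale act w" and gen: "generated_by scale act UNIV w = UNIV"
    using cyclic by (auto simp: cyclic_whittaker_vector_def)
  obtain n M where M: "M 0 = {0}" "M n = UNIV" "\<forall>i\<le>n. vir_submodule scale act (M i)"
    "\<forall>i<n. M i \<subset> M (Suc i) \<and> \<not> (\<exists>N. vir_submodule scale act N \<and> M i \<subset> N \<and> N \<subset> M (Suc i))"
    using assms(4) unfolding finite_length_def by blast
  have "w \<noteq> 0" using faithful[of 1] by auto
  then have "n \<noteq> 0" using M(1,2) by (cases n) auto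
  then have M1: "vir_submodule scale act (M 1)" "{0} \<subset> M 1"
    "\<And>N. vir_submodule scale act N \<Longrightarrow> {0} \<subset> N \<Longrightarrow> N \<subseteq> M 1 \<Longrightarrow> N = M 1"
    using M(1,3,4) by fastforce+
  then obtain x where "x \<in> M 1" "x \<noteq> 0" by auto
  then obtain r where r: "C r w \<in> M 1" "C r w \<noteq> 0"
    using nonzero_submodule_meets_center_orbit[OF psi w M1(1)] gen by blast
  let ?zr = "C (pCons 0 r) w"
  have zr: "?zr \<in> M 1" "?zr \<noteq> 0"
    using r submodule_center_act[OF M1(1) r(1), of "[:0, 1:]"] faithful[of "pCons 0 r"]
    by (auto simp flip: center_act_mult)
  have "generated_by scale act UNIV ?zr = M 1"
    by (rule M1(3)[OF submodule_generated_by])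
      (use zr generated_by_generator[of ?zr] M1 submodule_generated_by[of ?zr]
        generated_by_least[of "M 1" ?zr]
        in \<open>auto simp: stable_subspace_def V.subspace_0\<close>)
  with r obtain t where "C r w = C t ?zr"
    using whittaker_vectors_in_generated[OF psi whittaker_vector_center_act[OF w]
        whittaker_vector_center_act[OF w]] by metis
  then have "C (r - t * pCons 0 r) w = 0"
    by (simp only: center_act_diff center_act_mult) simp
  then have "r = t * pCons 0 r" using faithful by force
  then have "r * (1 - t * [:0, 1:]) = 0"
    by (simp add: algebra_simps)
  moreover have "r \<noteq> 0" using r by auto
  \<comment> \<open>\<open>1 - t z\<close> is not the zero polynomial because its value at 0 is 1.\<close>
  ultimately have "poly (1 - t * [:0, 1:]) 0 = 0" by simp
  then show False by simp
qed


section \<open>Homomorphisms out of a cyclic Whittaker module\<close>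

lemma virasoro_module_product:
  assumes "virasoro_module scaleV actV" "virasoro_module scaleW actW"
  shows "virasoro_module (\<lambda>c. map_prod (scaleV c) (scaleW c)) (\<lambda>x. map_prod (actV x) (actW x))"
proof -
  interpret V: virasoro_module scaleV actV by fact
  interpret W: virasoro_module scaleW actW by fact
  show ?thesis
    by unfold_locales
      (auto simp: V.V.scale_right_distrib V.V.scale_left_distrib W.V.scale_right_distrib
        W.V.scale_left_distrib V.act_add_left V.act_add_right W.act_add_left W.act_add_right
        V.act_scale_left V.act_scale_right W.act_scale_left W.act_scale_right
        V.act_bracket W.act_bracket)
qed

locale virasoro_module_pair =
  V: virasoro_module scaleV actV + W: virasoro_module scaleW actW
  for scaleV :: "complex \<Rightarrow> 'v::ab_group_add \<Rightarrow> 'v" and actV :: "virasoro \<Rightarrow> 'v \<Rightarrow> 'v"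
    and scaleW :: "complex \<Rightarrow> 'w::ab_group_add \<Rightarrow> 'w" and actW :: "virasoro \<Rightarrow> 'w \<Rightarrow> 'w"
begin

sublocale P: virasoro_module "\<lambda>c. map_prod (scaleV c) (scaleW c)" "\<lambda>x. map_prod (actV x) (actW x)"
  by (intro virasoro_module_product V.virasoro_module_axioms W.virasoro_module_axioms)

lemma center_act_product: "P.C p (x, y) = (V.C p x, W.C p y)"
  by (induction p) (simp_all add: P.center_act_pCons V.center_act_pCons W.center_act_pCons zero_prod_def)

abbreviation Hom :: "('v \<Rightarrow> 'w) set" where "Hom \<equiv> vir_Hom scaleV actV scaleW actW"

lemma Hom_iff:
  "f \<in> Hom \<longleftrightarrow> (\<forall>x y. f (x + y) = f x + f y) \<and> (\<forall>c x. f (scaleV c x) = scaleW c (f x)) \<and>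
     (\<forall>x u. f (actV x u) = actW x (f u))"
  by (auto simp: vir_Hom_def Vector_Spaces.linear_iff V.V.vector_space_axioms
      W.V.vector_space_axioms)

lemma Hom_zero: "f \<in> Hom \<Longrightarrow> f 0 = 0"
  by (metis Hom_iff add_cancel_left_left)

lemma Hom_center_act:
  assumes "f \<in> Hom"
  shows "f (V.C p x) = W.C p (f x)"
proof -
  have "f 0 = 0" using assms by (rule Hom_zero)
  with assms show ?thesis
    by (induction p) (auto simp: Hom_iff V.center_act_pCons W.center_act_pCons)
qed

lemma Hom_eqI:
  assumes "f \<in> Hom" "g \<in> Hom" "f v = g v" "generated_by scaleV actV UNIV v = UNIV"
  shows "f = g"
proof -
  have "V.V.subspace {x. f x = g x}"
    using assms(1,2) Hom_zero[OF assms(1)] Hom_zero[OF assms(2)]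
    by (intro V.V.subspaceI) (auto simp: Hom_iff)
  then have "vir_submodule scaleV actV {x. f x = g x}"
    using assms(1,2) by (auto simp: stable_subspace_def Hom_iff)
  from V.generated_by_least[OF this, of v] assms(3,4) show ?thesis by auto
qed

lemma Hom_whittaker_vector:
  "f \<in> Hom \<Longrightarrow> whittaker_vector \<psi> scaleV actV v \<Longrightarrow> whittaker_vector \<psi> scaleW actW (f v)"
  unfolding whittaker_vector_def Hom_iff by metis

text \<open>The graph of the homomorphism is the submodule \<open>G\<close> of \<open>V \<times> W\<close> generated by \<open>(v, w)\<close>. As \<open>(v, w)\<close>
  is a Whittaker vector, a nonzero submodule \<open>K = G \<inter> (0 \<times> W)\<close> would contain some nonzero
  \<open>(p(z) v, p(z) w)\<close>, with \<open>p(z) v = 0\<close> and hence \<open>p(z) w = 0\<close>.\<close>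

lemma Hom_extending:
  assumes psi: "nplus_character \<psi>" "\<exists>x\<in>nplus. \<psi> x \<noteq> 0"
    and v: "cyclic_whittaker_vector \<psi> scaleV actV v"
    and w: "whittaker_vector \<psi> scaleW actW w"
    and ann: "\<And>p. V.C p v = 0 \<Longrightarrow> W.C p w = 0"
  obtains f where "f \<in> Hom" "f v = w"
proof -
  define G where "G = generated_by (\<lambda>c. map_prod (scaleV c) (scaleW c))
    (\<lambda>x. map_prod (actV x) (actW x)) UNIV (v, w)"
  have G: "vir_submodule (\<lambda>c. map_prod (scaleV c) (scaleW c)) (\<lambda>x. map_prod (actV x) (actW x)) G"
    unfolding G_def by (rule P.submodule_generated_by)
  have G_zero: "(0, 0) \<in> G"
    using G P.V.subspace_0 by (auto simp: stable_subspace_def zero_prod_def)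
  have G_add: "(x + x', y + y') \<in> G" if "(x, y) \<in> G" "(x', y') \<in> G" for x x' y y'
    using G P.V.subspace_add[of G "(x, y)" "(x', y')"] that by (simp add: stable_subspace_def)
  have G_diff: "(x - x', y - y') \<in> G" if "(x, y) \<in> G" "(x', y') \<in> G" for x x' y y'
    using G P.V.subspace_diff[of G "(x, y)" "(x', y')"] that by (simp add: stable_subspace_def)
  have G_scale: "(scaleV c x, scaleW c y) \<in> G" if "(x, y) \<in> G" for c x y
    using G P.V.subspace_scale[of G "(x, y)" c] that by (simp add: stable_subspace_def)
  have G_act: "(actV g x, actW g y) \<in> G" if "(x, y) \<in> G" for g x y
    using G that unfolding stable_subspace_def by (metis UNIV_I map_prod_simp)
  have vw: "whittaker_vector \<psi> (\<lambda>c. map_prod (scaleV c) (scaleW c))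
      (\<lambda>x. map_prod (actV x) (actW x)) (v, w)"
    using v w by (simp add: cyclic_whittaker_vector_def whittaker_vector_def)
  have kernel: "y = 0" if y: "(0, y) \<in> G" for y
  proof (rule ccontr)
    assume "y \<noteq> 0"
    define K where "K = {u \<in> G. fst u = 0}"
    have "vir_submodule (\<lambda>c. map_prod (scaleV c) (scaleW c)) (\<lambda>x. map_prod (actV x) (actW x)) K"
      unfolding stable_subspace_def K_def
      by (intro conjI P.V.subspaceI)
        (auto simp: zero_prod_def G_zero intro: G_add[of 0 _ 0, simplified] dest: G_scale G_act)
    moreover have "K \<subseteq> G" by (auto simp: K_def)
    moreover have "(0, y) \<in> K" using y by (simp add: K_def)
    ultimately obtain p where "P.C p (v, w) \<in> K" "P.C p (v, w) \<noteq> 0"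
      using P.nonzero_submodule_meets_center_orbit[OF psi vw, of K "(0, y)"] \<open>y \<noteq> 0\<close>
      by (auto simp: zero_prod_def G_def)
    then show False
      using ann by (auto simp: K_def center_act_product zero_prod_def)
  qed
  have "vir_submodule scaleV actV {x. \<exists>y. (x, y) \<in> G}"
    unfolding stable_subspace_def
    by (intro conjI V.V.subspaceI) (use G_zero G_add G_scale G_act in blast)+
  moreover have vG: "(v, w) \<in> G" unfolding G_def by (rule P.generated_by_generator)
  ultimately have "generated_by scaleV actV UNIV v \<subseteq> {x. \<exists>y. (x, y) \<in> G}"
    by (intro V.generated_by_least) auto
  then have total: "\<exists>y. (x, y) \<in> G" for x
    using v by (auto simp: cyclic_whittaker_vector_def)
  define f where "f x = (SOME y. (x, y) \<in> G)" for x
  have f: "(x, f x) \<in> G" for x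
    unfolding f_def using total by (rule someI_ex)
  have f_eq: "f x = y" if "(x, y) \<in> G" for x y
    using kernel[of "f x - y"] G_diff[OF f[of x] that] by simp
  have "f \<in> Hom"
    unfolding Hom_iff using f by (auto intro!: f_eq G_add G_scale G_act)
  moreover have "f v = w" using vG by (rule f_eq)
  ultimately show ?thesis by (rule that)
qed

end

section \<open>The space of homomorphisms\<close>

lemma residue_class_eq_iff:
  "residue_class (principal_ideal g) s = residue_class (principal_ideal g) t \<longleftrightarrow> g dvd s - t"
proof
  assume "residue_class (principal_ideal g) s = residue_class (principal_ideal g) t"
  moreover have "s \<in> residue_class (principal_ideal g) s"
    by (auto simp: residue_class_def principal_ideal_def intro: exI[of _ 0])
  ultimately show "g dvd s - t"
    by (auto simp: residue_class_def principal_ideal_def)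
next
  assume "g dvd s - t"
  then obtain k where s: "s = t + g * k" by (metis dvdE diff_eq_eq add.commute)
  have "s + g * r = t + g * (k + r)" "t + g * r = s + g * (r - k)" for r
    by (simp_all add: s algebra_simps)
  then show "residue_class (principal_ideal g) s = residue_class (principal_ideal g) t"
    unfolding residue_class_def principal_ideal_def by blast
qed

theorem proposition4p3:
  fixes \<psi> :: "virasoro \<Rightarrow> complex"
    and scaleV :: "complex \<Rightarrow> 'v::ab_group_add \<Rightarrow> 'v" and actV :: "virasoro \<Rightarrow> 'v \<Rightarrow> 'v"
    and scaleW :: "complex \<Rightarrow> 'w::ab_group_add \<Rightarrow> 'w" and actW :: "virasoro \<Rightarrow> 'w \<Rightarrow> 'w"
    and v :: 'v and w :: 'w and p q :: "complex poly"
  assumes "nplus_character \<psi>" and "\<exists>x\<in>nplus. \<psi> x \<noteq> 0"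
    and "Wf_object \<psi> scaleV actV" and "Wf_object \<psi> scaleW actW"
    and "cyclic_whittaker_vector \<psi> scaleV actV v"
    and "cyclic_whittaker_vector \<psi> scaleW actW w"
    and "center_ann scaleV actV v = principal_ideal p"
    and "center_ann scaleW actW w = principal_ideal q"
  shows "\<exists>\<phi>. vs_isomorphism
             (poly_quotient (principal_ideal (gcd p q)))
             (quotient_add (principal_ideal (gcd p q)))
             (quotient_scale (principal_ideal (gcd p q)))
             (vir_Hom scaleV actV scaleW actW)
             (\<lambda>f g u. f u + g u)
             (\<lambda>c f u. scaleW c (f u))
             \<phi> \<and>
           (\<forall>s. \<phi> (residue_class (principal_ideal (gcd p q)) s) v =
                center_act scaleW actW (s * (q div gcd p q)) w)"
proof -
  note psi = assms(1,2)
  interpret virasoro_module_pair scaleV actV scaleW actW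
    using assms(3,4) by (simp add: virasoro_module_pair_def virasoro_module_def Wf_object_def)
  have v: "whittaker_vector \<psi> scaleV actV v" "generated_by scaleV actV UNIV v = UNIV"
    and w: "whittaker_vector \<psi> scaleW actW w" "generated_by scaleW actW UNIV w = UNIV"
    using assms(5,6) by (auto simp: cyclic_whittaker_vector_def)
  have annV: "V.C u v = 0 \<longleftrightarrow> p dvd u" for u
    using assms(7) by (auto simp: center_ann_def principal_ideal_def dvd_def set_eq_iff)
  have annW: "W.C u w = 0 \<longleftrightarrow> q dvd u" for u
    using assms(8) by (auto simp: center_ann_def principal_ideal_def dvd_def set_eq_iff)
  have "q \<noteq> 0"
    using W.center_ann_nonzero[OF psi assms(6)] assms(4) annW by (metis Wf_object_def dvd_0_left)
  define g h k where "g = gcd p q" and "h = q div g" and "k = p div g"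
  have q: "q = g * h" and p: "p = g * k"
    by (simp_all add: g_def h_def k_def)
  have "g \<noteq> 0" "h \<noteq> 0" using \<open>q \<noteq> 0\<close> q by auto
  have "coprime h k"
    using div_gcd_coprime[of p q] \<open>q \<noteq> 0\<close> by (simp add: g_def h_def k_def coprime_commute)
  let ?I = "principal_ideal g"
  let ?cl = "residue_class ?I"
  let ?w = "\<lambda>s. W.C (s * h) w"
  have w_eq_iff: "?w s = ?w t \<longleftrightarrow> g dvd s - t" for s t
  proof -
    have "?w s = ?w t \<longleftrightarrow> W.C ((s - t) * h) w = 0"
      by (simp add: left_diff_distrib W.center_act_diff)
    then show ?thesis using \<open>h \<noteq> 0\<close> by (simp add: annW q)
  qed
  have ex: "\<exists>f\<in>Hom. f v = ?w s" for s
  proof -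
    have "W.C u (?w s) = 0" if "V.C u v = 0" for u
    proof -
      have "g dvd u" using that by (auto simp: annV p)
      then have "q dvd u * (s * h)" by (simp add: q mult_dvd_mono)
      then show ?thesis by (simp add: annW flip: W.center_act_mult)
    qed
    then show ?thesis
      using Hom_extending[OF psi assms(5) W.whittaker_vector_center_act[OF w(1)]] by metis
  qed
  define \<phi> where "\<phi> A = (SOME f. f \<in> Hom \<and> (\<exists>s. A = ?cl s \<and> f v = ?w s))" for A
  have "\<exists>f. f \<in> Hom \<and> (\<exists>t. ?cl s = ?cl t \<and> f v = ?w t)" for s
    using ex[of s] by blast
  then have "\<phi> (?cl s) \<in> Hom \<and> (\<exists>t. ?cl s = ?cl t \<and> \<phi> (?cl s) v = ?w t)" for s
    unfolding \<phi>_def by (rule someI_ex)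
  then have \<phi>: "\<phi> (?cl s) \<in> Hom" "\<phi> (?cl s) v = ?w s" for s
    by (metis residue_class_eq_iff w_eq_iff)+
  have \<phi>_eqI: "\<phi> (?cl s) = f" if "f \<in> Hom" "f v = ?w s" for f s
    using that \<phi>[of s] v(2) by (intro Hom_eqI[of _ _ v]) auto
  have surj: "\<exists>s. f = \<phi> (?cl s)" if f: "f \<in> Hom" for f
  proof -
    have "f v \<in> generated_by scaleW actW UNIV w" using w(2) by simp
    then obtain r where r: "f v = W.C r w"
      using W.whittaker_vectors_in_generated[OF psi w(1) Hom_whittaker_vector[OF f v(1)]] by blast
    have "W.C (p * r) w = f (V.C p v)"
      by (simp add: Hom_center_act[OF f] r W.center_act_mult)
    also have "\<dots> = 0" using annV[of p] Hom_zero[OF f] by simp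
    finally have "g * h dvd g * (k * r)" by (simp add: annW p q mult.assoc)
    then have "h dvd k * r" using \<open>g \<noteq> 0\<close> by simp
    then have "h dvd r" using \<open>coprime h k\<close> by (simp add: coprime_dvd_mult_right_iff)
    then obtain s where "r = s * h" by (metis dvdE mult.commute)
    then show ?thesis using \<phi>_eqI[OF f] r by metis
  qed
  have "bij_betw \<phi> (poly_quotient ?I) Hom"
    unfolding bij_betw_def
  proof
    show "inj_on \<phi> (poly_quotient ?I)"
    proof (rule inj_onI)
      fix A B assume "A \<in> poly_quotient ?I" "B \<in> poly_quotient ?I" and eq: "\<phi> A = \<phi> B"
      then obtain s t where st: "A = ?cl s" "B = ?cl t" by (auto simp: poly_quotient_def)
      then have "?w s = ?w t" using eq \<phi>(2) by metis
      then show "A = B" by (simp add: st residue_class_eq_iff w_eq_iff)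
    qed
    show "\<phi> ` poly_quotient ?I = Hom"
      using surj \<phi>(1) by (auto simp: poly_quotient_def image_iff)
  qed
  moreover have "\<phi> (quotient_add ?I (?cl s) (?cl t)) = (\<lambda>u. \<phi> (?cl s) u + \<phi> (?cl t) u)" for s t
    unfolding quotient_add_residue_class
  proof (rule \<phi>_eqI)
    show "(\<lambda>u. \<phi> (?cl s) u + \<phi> (?cl t) u) \<in> Hom"
      using \<phi>(1)[of s] \<phi>(1)[of t]
      by (simp add: Hom_iff W.V.scale_right_distrib W.act_add_right algebra_simps)
  qed (simp add: \<phi>(2) distrib_right W.center_act_add)
  moreover have "\<phi> (quotient_scale ?I c (?cl s)) = (\<lambda>u. scaleW c (\<phi> (?cl s) u))" for c s
    unfolding quotient_scale_residue_class
  proof (rule \<phi>_eqI)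
    show "(\<lambda>u. scaleW c (\<phi> (?cl s) u)) \<in> Hom"
      using \<phi>(1)[of s]
      by (simp add: Hom_iff W.V.scale_right_distrib W.act_scale_right mult.commute)
  qed (simp add: \<phi>(2) W.center_act_smult)
  ultimately have "vs_isomorphism (poly_quotient ?I) (quotient_add ?I) (quotient_scale ?I)
      Hom (\<lambda>f g u. f u + g u) (\<lambda>c f u. scaleW c (f u)) \<phi>"
    unfolding vs_isomorphism_def by (auto simp: poly_quotient_def)
  with \<phi>(2) show ?thesis
    unfolding g_def[symmetric] h_def[symmetric] by blast
qed

end
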